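(* Suppose that $f:\mathbb{E}_1\to\mathbb{R}$ is $\alpha$-strongly convex, $\alpha>0$. Then the problem (OP) admits a unique optimal solution $\mathbf{q}^*$, and it satisfies the Primal Quadratic Gap property with the parameter $$\alpha_S=\min\left\{\frac{\alpha}{2},\frac{\alpha\rho}{\alpha+2\rho\|\mathcal{A}\|^2}\right\}>0.$$ In particular, for any fixed $\mathbf{w}\in\mathbb{E}_2$, the function $\mathbf{q}\mapsto S(\mathbf{q},\mathbf{w})$ is strongly convex.
   Context: Setting. $\mathbb{E}_1,\mathbb{E}_2$ are finite-dimensional Euclidean spaces, $\mathbb{E}=\mathbb{E}_1\times\mathbb{E}_2$, $f:\mathbb{E}_1\to\mathbb{R}$ is convex and $\beta$-smooth (differentiable with $\beta$-Lipschitz gradient), $\mathcal{R}_{\mathcal{X}}:\mathbb{E}_1\to(-\infty,\infty]$ and $\mathcal{R}_{\mathcal{Y}}:\mathbb{E}_2\to(-\infty,\infty]$ are proper, lower semicontinuous and convex, and $\mathcal{A}:\mathbb{E}_1\to\mathbb{E}_2$ is linear. The problem is $$\text{(OP)}\qquad \min_{\mathbf{x}\in\mathbb{E}_1,\mathbf{y}\in\mathbb{E}_2} f(\mathbf{x})+\mathcal{R}_{\mathcal{X}}(\mathbf{x})+\mathcal{R}_{\mathcal{Y}}(\mathbf{y})\quad\text{s.t.}\quad\mathcal{A}\mathbf{x}=\mathbf{y}.$$ Write $\mathbf{q}=(\mathbf{x},\mathbf{y})\in\mathbb{E}$, $\mathcal{R}_{\mathcal{Q}}(\mathbf{q})=\mathcal{R}_{\mathcal{X}}(\mathbf{x})+\mathcal{R}_{\mathcal{Y}}(\mathbf{y})$,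 $\mathcal{K}\mathbf{q}=\mathcal{A}\mathbf{x}-\mathbf{y}$. Norms are Euclidean; $\|\mathcal{A}\|$ is the spectral (operator) norm. Let $\mathcal{P}^*$ be the set of optimal solutions of (OP). For a fixed penalty parameter $\rho>0$, $$\mathcal{L}_\rho(\mathbf{q},\mathbf{w})=f(\mathbf{x})+\mathcal{R}_{\mathcal{Q}}(\mathbf{q})+\langle\mathbf{w},\mathcal{K}\mathbf{q}\rangle+\tfrac{\rho}{2}\|\mathcal{K}\mathbf{q}\|^2,\qquad S(\mathbf{q},\mathbf{w})=f(\mathbf{x})+\langle\mathbf{w},\mathcal{K}\mathbf{q}\rangle+\tfrac{\rho}{2}\|\mathcal{K}\mathbf{q}\|^2.$$ Standing assumptions: (1) $\mathcal{L}_\rho$ has a saddle point, i.e. there is $(\mathbf{q}^*,\mathbf{w}^* )\in\mathbb{E}\times\mathbb{E}_2$ with $\mathcal{L}_\rho(\mathbf{q}^*,\mathbf{w})\le\mathcal{L}_\rho(\mathbf{q}^*,\mathbf{w}^* )\le\mathcal{L}_\rho(\mathbf{q},\mathbf{w}^* )$ for all $\mathbf{q}\in\mathbb{E},\mathbf{w}\in\mathbb{E}_2$; (2) (Slater) there exist $\mathbf{x}\in\mathrm{ri}(\mathrm{dom} f\cap\mathrm{dom}\,\mathcal{R}_{\mathcal{X}})$ and $\mathbf{y}\in\mathrm{ri}(\mathrm{dom}\,\mathcal{R}_{\mathcal{Y}})$ with $\mathcal{A}\mathbf{x}=\mathbf{y}$, where ri denotes relative interior. Primal Quadratic Gap (PQG).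 (OP) satisfies PQG with parameter $\alpha_S>0$ if for every $\mathbf{q}\in\mathrm{dom}(\mathcal{R}_{\mathcal{Q}})$, the point $\mathbf{q}^*=\arg\min_{\mathbf{p}\in\mathcal{P}^*}\|\mathbf{q}-\mathbf{p}\|^2$ satisfies, for all $\mathbf{w}\in\mathbb{E}_2$, $$\langle\mathbf{q}^*-\mathbf{q},\nabla_{\mathbf{q}}S(\mathbf{q},\mathbf{w})\rangle\le S(\mathbf{q}^*,\mathbf{w})-S(\mathbf{q},\mathbf{w})-\tfrac{\alpha_S}{2}\|\mathbf{q}^*-\mathbf{q}\|^2.$$ *)

theory Defs
  imports "HOL-Analysis.Analysis"
begin

definition grad :: "('a::real_inner \<Rightarrow> real) \<Rightarrow> 'a \<Rightarrow> 'a" where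
  "grad F x = (THE D. GDERIV F x :> D)"

lemma grad_eqI:
  assumes "GDERIV F x :> D"
  shows "grad F x = D"
  unfolding grad_def
proof (rule the_equality)
  show "GDERIV F x :> D" by (rule assms)
next
  fix D' assume "GDERIV F x :> D'"
  with assms have "(\<lambda>h. inner h D') = (\<lambda>h. inner h D)"
    unfolding gderiv_def using has_derivative_unique by blast
  then have "inner (D' - D) D' = inner (D' - D) D"
    by meson
  then have "inner (D' - D) (D' - D) = 0"
    by (simp add: inner_diff_right)
  then show "D' = D" by simp
qed

definition smooth_fun :: "real \<Rightarrow> ('a::euclidean_space \<Rightarrow> real) \<Rightarrow> bool" where
  "smooth_fun \<beta> F \<longleftrightarrow> (\<forall>x. F differentiable (at x)) \<and> \<beta>-lipschitz_on UNIV (grad F)"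

definition strongly_convex :: "real \<Rightarrow> ('a::real_inner \<Rightarrow> real) \<Rightarrow> bool" where
  "strongly_convex \<mu> F \<longleftrightarrow>
    (\<forall>x y. \<forall>u\<ge>0. \<forall>v\<ge>0. u + v = 1 \<longrightarrow>
       F (u *\<^sub>R x + v *\<^sub>R y) \<le> u * F x + v * F y - \<mu> / 2 * u * v * (norm (x - y))\<^sup>2)"

definition eff_dom :: "('a \<Rightarrow> ereal) \<Rightarrow> 'a set" where
  "eff_dom R = {x. R x < \<infinity>}"

definition proper_fun :: "('a \<Rightarrow> ereal) \<Rightarrow> bool" where
  "proper_fun R \<longleftrightarrow> (\<forall>x. R x \<noteq> -\<infinity>) \<and> eff_dom R \<noteq> {}"

definition lsc_fun :: "('a::topological_space \<Rightarrow> ereal) \<Rightarrow> bool" where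
  "lsc_fun R \<longleftrightarrow> (\<forall>x. R x \<le> Liminf (at x) R)"

(* Only applied to functions that never take the value -\<infinity>, so the right-hand side is
   never of the form \<infinity> + -\<infinity>; since 0 * \<infinity> = 0 for ereal, the cases u = 0 and v = 0 are
   trivially satisfied. *)
definition convex_fun :: "('a::real_vector \<Rightarrow> ereal) \<Rightarrow> bool" where
  "convex_fun R \<longleftrightarrow>
    (\<forall>x y. \<forall>u\<ge>0. \<forall>v\<ge>0. u + v = 1 \<longrightarrow>
       R (u *\<^sub>R x + v *\<^sub>R y) \<le> ereal u * R x + ereal v * R y)"

definition RQ :: "('a \<Rightarrow> ereal) \<Rightarrow> ('b \<Rightarrow> ereal) \<Rightarrow> 'a \<times> 'b \<Rightarrow> ereal" where
  "RQ RX RY q = RX (fst q) + RY (snd q)"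

definition K_op :: "('a \<Rightarrow> 'b) \<Rightarrow> 'a \<times> 'b \<Rightarrow> 'b::minus" where
  "K_op A q = A (fst q) - snd q"

definition optimal_set ::
  "('a \<Rightarrow> real) \<Rightarrow> ('a \<Rightarrow> ereal) \<Rightarrow> ('b \<Rightarrow> ereal) \<Rightarrow> ('a \<Rightarrow> 'b) \<Rightarrow> ('a \<times> 'b) set" where
  "optimal_set f RX RY A =
    {q. is_arg_min (\<lambda>p. ereal (f (fst p)) + RX (fst p) + RY (snd p))
          (\<lambda>p. A (fst p) = snd p) q}"

definition S_fun ::
  "('a \<Rightarrow> real) \<Rightarrow> ('a \<Rightarrow> 'b::real_inner) \<Rightarrow> real \<Rightarrow> 'a \<times> 'b \<Rightarrow> 'b \<Rightarrow> real" where
  "S_fun f A \<rho> q w = f (fst q) + inner w (K_op A q) + \<rho> / 2 * (norm (K_op A q))\<^sup>2"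

definition aug_lagrangian ::
  "('a \<Rightarrow> real) \<Rightarrow> ('a \<Rightarrow> ereal) \<Rightarrow> ('b \<Rightarrow> ereal) \<Rightarrow> ('a \<Rightarrow> 'b::real_inner) \<Rightarrow> real
    \<Rightarrow> 'a \<times> 'b \<Rightarrow> 'b \<Rightarrow> ereal" where
  "aug_lagrangian f RX RY A \<rho> q w =
    ereal (f (fst q)) + RQ RX RY q + ereal (inner w (K_op A q))
      + ereal (\<rho> / 2 * (norm (K_op A q))\<^sup>2)"

definition has_saddle_point :: "('q \<Rightarrow> 'w \<Rightarrow> ereal) \<Rightarrow> bool" where
  "has_saddle_point L \<longleftrightarrow>
    (\<exists>qs ws. \<forall>q w. L qs w \<le> L qs ws \<and> L qs ws \<le> L q ws)"

definition slater ::
  "('a::euclidean_space \<Rightarrow> real) \<Rightarrow> ('a \<Rightarrow> ereal) \<Rightarrow> ('b::euclidean_space \<Rightarrow> ereal)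
    \<Rightarrow> ('a \<Rightarrow> 'b) \<Rightarrow> bool" where
  "slater f RX RY A \<longleftrightarrow>
    (\<exists>x y. x \<in> rel_interior (eff_dom (\<lambda>z. ereal (f z)) \<inter> eff_dom RX)
         \<and> y \<in> rel_interior (eff_dom RY) \<and> A x = y)"

(* The projection of q onto the optimal set is required to exist and to be unique, which is
   what the phrase "the point argmin" presupposes. *)
definition PQG ::
  "('a::euclidean_space \<Rightarrow> real) \<Rightarrow> ('a \<Rightarrow> ereal) \<Rightarrow> ('b::euclidean_space \<Rightarrow> ereal)
    \<Rightarrow> ('a \<Rightarrow> 'b) \<Rightarrow> real \<Rightarrow> real \<Rightarrow> bool" where
  "PQG f RX RY A \<rho> \<alpha>S \<longleftrightarrow>
    \<alpha>S > 0 \<and>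
    (\<forall>q \<in> eff_dom (RQ RX RY). \<exists>qs.
       (\<forall>p. is_arg_min (\<lambda>p. (norm (q - p))\<^sup>2) (\<lambda>p. p \<in> optimal_set f RX RY A) p \<longleftrightarrow> p = qs) \<and>
       (\<forall>w. inner (qs - q) (grad (\<lambda>p. S_fun f A \<rho> p w) q)
              \<le> S_fun f A \<rho> qs w - S_fun f A \<rho> q w - \<alpha>S / 2 * (norm (qs - q))\<^sup>2))"

end

theory Submission
  imports Defs
begin

text \<open>
  Everything comes from joint strong convexity of \<open>S\<close> in \<open>q = (x, y)\<close>. Along a displacement
  \<open>(a, b)\<close>, the strong convexity of \<open>f\<close> contributes \<open>\<alpha> / 2 * \<parallel>a\<parallel>\<^sup>2\<close>, which controls only \<open>x\<close>, and the
  penalty contributes \<open>\<rho> / 2 * \<parallel>A a - b\<parallel>\<^sup>2\<close>. Since \<open>\<parallel>b\<parallel> \<le> \<parallel>A\<parallel> \<parallel>a\<parallel> + \<parallel>A a - b\<parallel>\<close>, half of the first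
  term together with the second controls \<open>\<parallel>b\<parallel>\<^sup>2\<close>, and the other half controls \<open>\<parallel>a\<parallel>\<^sup>2\<close>; the two
  entries of the minimum defining \<open>\<alpha>\<^sub>S\<close> are the constants of these two bounds
  (\<open>coupled_norm_bound\<close>, \<open>strongly_convex_S_fun\<close>). The first-order form of strong convexity
  (\<open>strongly_convex_first_order\<close>) then gives the inequality of the gap property between any two
  points, in particular between \<open>q\<close> and its projection.

  It remains to see that the optimal set is a singleton. A saddle value is finite because the
  problem has a feasible point of finite cost; the supremum over the multiplier being attained then
  forces feasibility of the primal part, and minimality over \<open>q\<close> reduces to optimality on the
  feasible set (\<open>saddle_point_imp_optimal\<close>). Uniqueness is strict convexity of \<open>f\<close> in \<open>x\<close>, with \<open>y\<close>
  determined by \<open>A x = y\<close> (\<open>optimal_set_unique\<close>).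
\<close>

section \<open>Strong convexity and gradients\<close>

text \<open>The Riesz representative of the derivative is its adjoint applied to \<open>1\<close>.\<close>

lemma differentiable_imp_GDERIV_grad:
  fixes F :: "'a::euclidean_space \<Rightarrow> real"
  assumes "F differentiable (at x)"
  shows "GDERIV F x :> grad F x"
proof -
  obtain F' where F': "(F has_derivative F') (at x)"
    using assms unfolding differentiable_def by blast
  have "F' = (\<lambda>h. inner h (adjoint F' 1))"
    using adjoint_works[OF has_derivative_linear[OF F']] by auto
  with F' have "GDERIV F x :> adjoint F' 1"
    unfolding gderiv_def by metis
  then show ?thesis
    using grad_eqI by metis
qed

text \<open>
  On the segment from \<open>x\<close> to \<open>y\<close>, strong convexity bounds the difference quotient at \<open>x\<close> of step \<open>t\<close>
  by \<open>F y - F x - \<mu> / 2 * (1 - t) * \<parallel>y - x\<parallel>\<^sup>2\<close>; let \<open>t\<close> tend to \<open>0\<close>.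
\<close>

lemma strongly_convex_first_order:
  fixes F :: "'a::euclidean_space \<Rightarrow> real"
  assumes sc: "strongly_convex \<mu> F" and diff: "F differentiable (at x)"
  shows "inner (y - x) (grad F x) \<le> F y - F x - \<mu> / 2 * (norm (y - x))\<^sup>2"
proof -
  define d where "d = y - x"
  have g: "(F has_derivative (\<lambda>h. inner h (grad F x))) (at x)"
    using differentiable_imp_GDERIV_grad[OF diff] unfolding gderiv_def .
  have l: "((\<lambda>t::real. x + t *\<^sub>R d) has_derivative (\<lambda>t. t *\<^sub>R d)) (at 0)"
    by (auto intro!: derivative_eq_intros)
  have "((\<lambda>t. F (x + t *\<^sub>R d)) has_derivative (\<lambda>t. inner (t *\<^sub>R d) (grad F x))) (at 0)"
    using has_derivative_compose[OF l, of F "\<lambda>h. inner h (grad F x)"] g by simp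
  then have "((\<lambda>t. F (x + t *\<^sub>R d)) has_real_derivative inner d (grad F x)) (at 0)"
    unfolding has_field_derivative_def by (simp add: mult.commute[of _ "inner d (grad F x)"])
  then have lim: "((\<lambda>t. (F (x + t *\<^sub>R d) - F x) / t) \<longlongrightarrow> inner d (grad F x)) (at_right 0)"
    unfolding DERIV_def by (auto intro: tendsto_within_subset)
  have lim': "((\<lambda>t. F y - F x - \<mu> / 2 * (1 - t) * (norm d)\<^sup>2)
      \<longlongrightarrow> F y - F x - \<mu> / 2 * (1 - 0) * (norm d)\<^sup>2) (at_right 0)"
    by (intro tendsto_intros)
  have quot: "(F (x + t *\<^sub>R d) - F x) / t \<le> F y - F x - \<mu> / 2 * (1 - t) * (norm d)\<^sup>2"
    if t: "0 < t" "t < 1" for t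
  proof -
    have seg: "x + t *\<^sub>R d = (1 - t) *\<^sub>R x + t *\<^sub>R y"
      unfolding d_def by (simp add: algebra_simps)
    have "F ((1 - t) *\<^sub>R x + t *\<^sub>R y)
        \<le> (1 - t) * F x + t * F y - \<mu> / 2 * (1 - t) * t * (norm (x - y))\<^sup>2"
      using sc t unfolding strongly_convex_def by simp
    then have "F (x + t *\<^sub>R d) - F x \<le> (F y - F x - \<mu> / 2 * (1 - t) * (norm d)\<^sup>2) * t"
      unfolding seg d_def norm_minus_commute[of x y] by (simp add: algebra_simps)
    then show ?thesis
      using t by (simp add: divide_le_eq)
  qed
  have "inner d (grad F x) \<le> F y - F x - \<mu> / 2 * (1 - 0) * (norm d)\<^sup>2"
  proof (rule tendsto_le[OF _ lim' lim])
    show "\<forall>\<^sub>F t in at_right 0. (F (x + t *\<^sub>R d) - F x) / t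
        \<le> F y - F x - \<mu> / 2 * (1 - t) * (norm d)\<^sup>2"
      unfolding eventually_at_right_field using quot by (intro exI[of _ 1]) auto
  qed simp
  then show ?thesis
    unfolding d_def by simp
qed

section \<open>Strong convexity of the smooth part\<close>

lemma gap_parameter_pos:
  fixes \<alpha> \<rho> :: real
  assumes "\<alpha> > 0" "\<rho> > 0"
  shows "min (\<alpha> / 2) (\<alpha> * \<rho> / (\<alpha> + 2 * \<rho> * n\<^sup>2)) > 0"
proof -
  have "\<alpha> + 2 * \<rho> * n\<^sup>2 > 0"
    using assms by (intro add_pos_nonneg) auto
  then show ?thesis
    using assms by simp
qed

text \<open>
  The weighted Cauchy--Schwarz inequality
  \<open>(n s + t)\<^sup>2 \<le> (2 n\<^sup>2 / \<alpha> + 1 / \<rho>) (\<alpha> / 2 * s\<^sup>2 + \<rho> t\<^sup>2)\<close> with \<open>s = \<parallel>a\<parallel>\<close>, \<open>t = \<parallel>A a - b\<parallel>\<close> bounds \<open>\<parallel>b\<parallel>\<^sup>2\<close>.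
  The second entry of the minimum is the reciprocal of the Cauchy--Schwarz constant.
\<close>

lemma coupled_norm_bound:
  fixes A :: "'a::euclidean_space \<Rightarrow> 'b::euclidean_space" and \<alpha> \<rho> :: real
  assumes "linear A" and pos: "\<alpha> > 0" "\<rho> > 0"
  shows "min (\<alpha> / 2) (\<alpha> * \<rho> / (\<alpha> + 2 * \<rho> * (onorm A)\<^sup>2)) * ((norm a)\<^sup>2 + (norm b)\<^sup>2)
    \<le> \<alpha> * (norm a)\<^sup>2 + \<rho> * (norm (A a - b))\<^sup>2"
proof -
  define n where "n = onorm A"
  define s where "s = norm a"
  define t where "t = norm (A a - b)"
  define D where "D = \<alpha> + 2 * \<rho> * n\<^sup>2"
  define c where "c = min (\<alpha> / 2) (\<alpha> * \<rho> / D)"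
  have D: "D > 0"
    unfolding D_def using pos by (intro add_pos_nonneg) auto
  have c0: "c > 0"
    unfolding c_def D_def by (rule gap_parameter_pos[OF pos])
  have "norm (A a) \<le> n * s"
    unfolding n_def s_def using assms(1) by (simp add: linear_linear onorm)
  moreover have "norm b \<le> norm (A a) + t"
    unfolding t_def using norm_triangle_ineq4[of "A a" "A a - b"] by simp
  ultimately have b: "(norm b)\<^sup>2 \<le> (n * s + t)\<^sup>2"
    by (intro power_mono) auto
  have "\<alpha> * \<rho> * (n * s + t)\<^sup>2 \<le> D * (\<alpha> / 2 * s\<^sup>2 + \<rho> * t\<^sup>2)"
  proof -
    \<comment> \<open>Lagrange's identity\<close>
    have "D * (\<alpha> / 2 * s\<^sup>2 + \<rho> * t\<^sup>2) - \<alpha> * \<rho> * (n * s + t)\<^sup>2 = (\<alpha> * s - 2 * \<rho> * n * t)\<^sup>2 / 2"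
      unfolding D_def by (simp add: field_simps power2_eq_square)
    then show ?thesis
      by (smt (verit) zero_le_power2 divide_nonneg_nonneg)
  qed
  then have "(n * s + t)\<^sup>2 * (\<alpha> * \<rho> / D) \<le> \<alpha> / 2 * s\<^sup>2 + \<rho> * t\<^sup>2"
    using D by (simp add: field_simps)
  then have CS: "c * (n * s + t)\<^sup>2 \<le> \<alpha> / 2 * s\<^sup>2 + \<rho> * t\<^sup>2"
    using mult_right_mono[of c "\<alpha> * \<rho> / D" "(n * s + t)\<^sup>2"] unfolding c_def
    by (simp add: mult.commute)
  have "c * (norm b)\<^sup>2 \<le> \<alpha> / 2 * s\<^sup>2 + \<rho> * t\<^sup>2"
    using mult_left_mono[OF b less_imp_le[OF c0]] CS by (rule order.trans)
  moreover have "c * s\<^sup>2 \<le> \<alpha> / 2 * s\<^sup>2"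
    unfolding c_def by (intro mult_right_mono min.cobounded1 zero_le_power2)
  ultimately have "c * (s\<^sup>2 + (norm b)\<^sup>2) \<le> \<alpha> * s\<^sup>2 + \<rho> * t\<^sup>2"
    by (simp add: algebra_simps)
  then show ?thesis
    unfolding c_def D_def n_def s_def t_def .
qed

lemma norm_sq_convex_combination:
  fixes x y :: "'a::real_inner"
  assumes "u + v = 1"
  shows "(norm (u *\<^sub>R x + v *\<^sub>R y))\<^sup>2
    = u * (norm x)\<^sup>2 + v * (norm y)\<^sup>2 - u * v * (norm (x - y))\<^sup>2"
proof -
  have v: "v = 1 - u"
    using assms by simp
  show ?thesis
    unfolding v power2_norm_eq_inner
    by (simp add: inner_add_left inner_add_right inner_diff_left inner_diff_right
        inner_commute[of y x] algebra_simps power2_eq_square)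
qed

lemma linear_K_op:
  assumes "linear A"
  shows "linear (K_op A)"
proof -
  interpret linear A by fact
  show ?thesis
    by (rule linearI) (simp_all add: K_op_def add scale scaleR_diff_right)
qed

lemma strongly_convex_S_fun:
  fixes f :: "'a::euclidean_space \<Rightarrow> real" and A :: "'a \<Rightarrow> 'b::euclidean_space"
  assumes A: "linear A" and pos: "\<alpha> > 0" "\<rho> > 0" and f: "strongly_convex \<alpha> f"
  shows "strongly_convex (min (\<alpha> / 2) (\<alpha> * \<rho> / (\<alpha> + 2 * \<rho> * (onorm A)\<^sup>2)))
    (\<lambda>q. S_fun f A \<rho> q w)"
  unfolding strongly_convex_def
proof (intro allI impI)
  fix p q :: "'a \<times> 'b" and u v :: real
  assume uv: "0 \<le> u" "0 \<le> v" "u + v = 1"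
  define c where "c = min (\<alpha> / 2) (\<alpha> * \<rho> / (\<alpha> + 2 * \<rho> * (onorm A)\<^sup>2))"
  define P where "P = K_op A p"
  define Q where "Q = K_op A q"
  have K: "K_op A (u *\<^sub>R p + v *\<^sub>R q) = u *\<^sub>R P + v *\<^sub>R Q"
    unfolding P_def Q_def using linear_K_op[OF A] by (simp add: linear_add linear_scale)
  have diff: "P - Q = A (fst p - fst q) - (snd p - snd q)"
    unfolding P_def Q_def K_op_def using A by (simp add: linear_diff)
  have "c * (norm (p - q))\<^sup>2 = c * ((norm (fst p - fst q))\<^sup>2 + (norm (snd p - snd q))\<^sup>2)"
    by (cases p; cases q) (simp add: norm_Pair)
  also have "\<dots> \<le> \<alpha> * (norm (fst p - fst q))\<^sup>2 + \<rho> * (norm (P - Q))\<^sup>2"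
    unfolding c_def diff by (rule coupled_norm_bound[OF A pos])
  finally have "u * v / 2 * (c * (norm (p - q))\<^sup>2)
      \<le> u * v / 2 * (\<alpha> * (norm (fst p - fst q))\<^sup>2 + \<rho> * (norm (P - Q))\<^sup>2)"
    using uv by (intro mult_left_mono) auto
  moreover have "f (u *\<^sub>R fst p + v *\<^sub>R fst q)
      \<le> u * f (fst p) + v * f (fst q) - \<alpha> / 2 * u * v * (norm (fst p - fst q))\<^sup>2"
    using f uv unfolding strongly_convex_def by blast
  moreover have "\<rho> / 2 * (norm (u *\<^sub>R P + v *\<^sub>R Q))\<^sup>2
      = \<rho> / 2 * (u * (norm P)\<^sup>2 + v * (norm Q)\<^sup>2 - u * v * (norm (P - Q))\<^sup>2)"
    using norm_sq_convex_combination[OF uv(3)] by metis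
  ultimately show "S_fun f A \<rho> (u *\<^sub>R p + v *\<^sub>R q) w
      \<le> u * S_fun f A \<rho> p w + v * S_fun f A \<rho> q w
        - min (\<alpha> / 2) (\<alpha> * \<rho> / (\<alpha> + 2 * \<rho> * (onorm A)\<^sup>2)) / 2 * u * v * (norm (p - q))\<^sup>2"
    unfolding S_fun_def K P_def[symmetric] Q_def[symmetric] c_def[symmetric]
    by (simp add: inner_add_right algebra_simps)
qed

lemma S_fun_differentiable:
  fixes f :: "'a::euclidean_space \<Rightarrow> real" and A :: "'a \<Rightarrow> 'b::euclidean_space"
  assumes A: "linear A" and f: "\<And>x. f differentiable (at x)"
  shows "(\<lambda>p. S_fun f A \<rho> p w) differentiable (at q)"
proof -
  have "(\<lambda>p. f (fst p)) differentiable (at q)"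
    using differentiable_chain_at[OF linear_imp_differentiable[OF linear_fst] f]
    by (simp add: o_def)
  moreover have K: "K_op A differentiable (at q)"
    by (rule linear_imp_differentiable[OF linear_K_op[OF A]])
  ultimately show ?thesis
    unfolding S_fun_def power2_norm_eq_inner
    by (intro differentiable_add differentiable_mult differentiable_inner differentiable_const)
qed

section \<open>The optimal set is a singleton\<close>

text \<open>
  Any \<open>w\<close> is admissible in the left saddle inequality; testing with \<open>w\<^sup>* + K q\<^sup>*\<close> adds \<open>\<parallel>K q\<^sup>*\<parallel>\<^sup>2\<close> to a
  finite value, so \<open>K q\<^sup>* = 0\<close>.
\<close>

lemma saddle_point_imp_optimal:
  fixes A :: "'a \<Rightarrow> 'b::real_inner"
  assumes RX: "\<And>x. RX x \<noteq> -\<infinity>" and RY: "\<And>y. RY y \<noteq> -\<infinity>"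
    and feas: "RX x0 < \<infinity>" "RY (A x0) < \<infinity>"
    and left: "\<And>w. aug_lagrangian f RX RY A \<rho> qs w \<le> aug_lagrangian f RX RY A \<rho> qs ws"
    and right: "\<And>q. aug_lagrangian f RX RY A \<rho> qs ws \<le> aug_lagrangian f RX RY A \<rho> q ws"
  shows "qs \<in> optimal_set f RX RY A"
proof -
  have on_feas: "aug_lagrangian f RX RY A \<rho> q ws = ereal (f (fst q)) + RX (fst q) + RY (snd q)"
    if "A (fst q) = snd q" for q
    using that by (simp add: aug_lagrangian_def RQ_def K_op_def add.assoc zero_ereal_def[symmetric])
  have "aug_lagrangian f RX RY A \<rho> (x0, A x0) ws < \<infinity>"
    using feas by (simp add: on_feas)
  then have fin: "aug_lagrangian f RX RY A \<rho> qs ws < \<infinity>"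
    using right[of "(x0, A x0)"] by (rule order.strict_trans1[rotated])
  obtain r where r: "RQ RX RY qs = ereal r"
    using fin RX[of "fst qs"] RY[of "snd qs"] unfolding aug_lagrangian_def RQ_def
    by (cases "RX (fst qs)"; cases "RY (snd qs)") auto
  have "inner (K_op A qs) (K_op A qs) \<le> 0"
    using left[of "ws + K_op A qs"] unfolding aug_lagrangian_def r
    by (simp add: inner_add_left)
  then have "K_op A qs = 0"
    by (metis inner_ge_zero inner_eq_zero_iff order.antisym)
  then have feas_qs: "A (fst qs) = snd qs"
    by (simp add: K_op_def)
  have "ereal (f (fst qs)) + RX (fst qs) + RY (snd qs) \<le> ereal (f (fst p)) + RX (fst p) + RY (snd p)"
    if "A (fst p) = snd p" for p
    using right[of p] by (simp add: on_feas[OF feas_qs] on_feas[OF that])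
  then show ?thesis
    unfolding optimal_set_def is_arg_min_def using feas_qs by (auto simp: not_less)
qed

text \<open>
  If two optimal points had different first components, their midpoint would be feasible and beat
  their common cost by \<open>\<alpha> / 8 * \<parallel>x\<^sub>1 - x\<^sub>2\<parallel>\<^sup>2\<close>. The feasible point of finite cost makes that cost a real
  number, so that a strict gain is possible.
\<close>

lemma optimal_set_unique:
  fixes f :: "'a::real_inner \<Rightarrow> real" and A :: "'a \<Rightarrow> 'b::real_vector"
  assumes RX: "\<And>x. RX x \<noteq> -\<infinity>" "convex_fun RX" and RY: "\<And>y. RY y \<noteq> -\<infinity>" "convex_fun RY"
    and A: "linear A" and f: "\<alpha> > 0" "strongly_convex \<alpha> f"
    and feas: "RX x0 < \<infinity>" "RY (A x0) < \<infinity>"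
    and p: "p \<in> optimal_set f RX RY A" and q: "q \<in> optimal_set f RX RY A"
  shows "p = q"
proof -
  define J where "J = (\<lambda>q. ereal (f (fst q)) + RX (fst q) + RY (snd q))"
  have opt: "A (fst z) = snd z" "\<And>z'. A (fst z') = snd z' \<Longrightarrow> J z \<le> J z'"
    if "z \<in> optimal_set f RX RY A" for z
    using that unfolding optimal_set_def is_arg_min_def J_def by (auto simp: not_less)
  have finite_cost: "\<exists>r s. RX (fst z) = ereal r \<and> RY (snd z) = ereal s"
    if "z \<in> optimal_set f RX RY A" for z
  proof -
    have "J (x0, A x0) < \<infinity>"
      using feas by (simp add: J_def)
    then have "J z < \<infinity>"
      using opt(2)[OF that, of "(x0, A x0)"] by (auto intro: order.strict_trans1)
    then show ?thesis
      using RX(1)[of "fst z"] RY(1)[of "snd z"] unfolding J_def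
      by (cases "RX (fst z)"; cases "RY (snd z)") auto
  qed
  obtain r s where rs: "RX (fst p) = ereal r" "RY (snd p) = ereal s"
    using finite_cost[OF p] by blast
  obtain r' s' where rs': "RX (fst q) = ereal r'" "RY (snd q) = ereal s'"
    using finite_cost[OF q] by blast
  define m where "m = (1/2) *\<^sub>R p + (1/2) *\<^sub>R q"
  have m_feas: "A (fst m) = snd m"
    unfolding m_def using A opt(1)[OF p] opt(1)[OF q] by (simp add: linear_add linear_scale)
  have X: "RX (fst m) \<le> ereal (r / 2 + r' / 2)"
    using RX(2)[unfolded convex_fun_def, rule_format, of "1/2" "1/2" "fst p" "fst q"] rs rs'
    unfolding m_def by simp
  have Y: "RY (snd m) \<le> ereal (s / 2 + s' / 2)"
    using RY(2)[unfolded convex_fun_def, rule_format, of "1/2" "1/2" "snd p" "snd q"] rs rs'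
    unfolding m_def by simp
  have F: "f (fst m) \<le> f (fst p) / 2 + f (fst q) / 2 - \<alpha> / 8 * (norm (fst p - fst q))\<^sup>2"
    using f(2)[unfolded strongly_convex_def, rule_format, of "1/2" "1/2" "fst p" "fst q"]
    unfolding m_def by simp
  have "J m \<le> ereal (f (fst p) / 2 + f (fst q) / 2 - \<alpha> / 8 * (norm (fst p - fst q))\<^sup>2)
      + ereal (r / 2 + r' / 2) + ereal (s / 2 + s' / 2)"
    unfolding J_def using X Y F by (intro add_mono) auto
  then have up: "J m \<le> ereal (f (fst p) / 2 + f (fst q) / 2 - \<alpha> / 8 * (norm (fst p - fst q))\<^sup>2
      + (r / 2 + r' / 2) + (s / 2 + s' / 2))"
    by simp
  have "ereal (f (fst p) + r + s) \<le> J m" "ereal (f (fst q) + r' + s') \<le> J m"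
    using opt(2)[OF p m_feas] opt(2)[OF q m_feas] rs rs' by (simp_all add: J_def)
  with up have "ereal (f (fst p) + r + s)
      \<le> ereal (f (fst p) / 2 + f (fst q) / 2 - \<alpha> / 8 * (norm (fst p - fst q))\<^sup>2
        + (r / 2 + r' / 2) + (s / 2 + s' / 2))"
    and "ereal (f (fst q) + r' + s')
      \<le> ereal (f (fst p) / 2 + f (fst q) / 2 - \<alpha> / 8 * (norm (fst p - fst q))\<^sup>2
        + (r / 2 + r' / 2) + (s / 2 + s' / 2))"
    by (meson order.trans)+
  then have "\<alpha> * (norm (fst p - fst q))\<^sup>2 \<le> 0"
    by simp
  then have "fst p = fst q"
    using f(1) by (simp add: mult_le_0_iff)
  then show "p = q"
    using opt(1)[OF p] opt(1)[OF q] by (metis prod_eqI)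
qed

section \<open>Primal quadratic gap under strong convexity\<close>

theorem theorem1:
  fixes f :: "'a::euclidean_space \<Rightarrow> real"
    and RX :: "'a \<Rightarrow> ereal"
    and RY :: "'b::euclidean_space \<Rightarrow> ereal"
    and A :: "'a \<Rightarrow> 'b"
    and \<alpha> \<beta> \<rho> :: real
  assumes "convex_on UNIV f"
    and "smooth_fun \<beta> f"
    and "proper_fun RX" and "lsc_fun RX" and "convex_fun RX"
    and "proper_fun RY" and "lsc_fun RY" and "convex_fun RY"
    and "linear A"
    and "\<rho> > 0"
    and "has_saddle_point (aug_lagrangian f RX RY A \<rho>)"
    and "slater f RX RY A"
    and "\<alpha> > 0"
    and "strongly_convex \<alpha> f"
  shows "(\<exists>!qs. qs \<in> optimal_set f RX RY A)
    \<and> min (\<alpha> / 2) (\<alpha> * \<rho> / (\<alpha> + 2 * \<rho> * (onorm A)\<^sup>2)) > 0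
    \<and> PQG f RX RY A \<rho> (min (\<alpha> / 2) (\<alpha> * \<rho> / (\<alpha> + 2 * \<rho> * (onorm A)\<^sup>2)))
    \<and> (\<forall>w. \<exists>\<mu>>0. strongly_convex \<mu> (\<lambda>q. S_fun f A \<rho> q w))"
proof -
  define c where "c = min (\<alpha> / 2) (\<alpha> * \<rho> / (\<alpha> + 2 * \<rho> * (onorm A)\<^sup>2))"
  have c: "c > 0"
    unfolding c_def using gap_parameter_pos[OF \<open>\<alpha> > 0\<close> \<open>\<rho> > 0\<close>] .
  have S: "strongly_convex c (\<lambda>q. S_fun f A \<rho> q w)" for w
    unfolding c_def
    using strongly_convex_S_fun[OF \<open>linear A\<close> \<open>\<alpha> > 0\<close> \<open>\<rho> > 0\<close> \<open>strongly_convex \<alpha> f\<close>] .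
  have bot: "RX x \<noteq> -\<infinity>" "RY y \<noteq> -\<infinity>" for x y
    using \<open>proper_fun RX\<close> \<open>proper_fun RY\<close> unfolding proper_fun_def by auto
  obtain x0 where x0: "RX x0 < \<infinity>" "RY (A x0) < \<infinity>"
  proof -
    obtain x y where x: "x \<in> rel_interior (eff_dom (\<lambda>z. ereal (f z)) \<inter> eff_dom RX)"
      and y: "y \<in> rel_interior (eff_dom RY)" and "A x = y"
      using \<open>slater f RX RY A\<close> unfolding slater_def by auto
    moreover have "x \<in> eff_dom RX" "y \<in> eff_dom RY"
      using subsetD[OF rel_interior_subset x] subsetD[OF rel_interior_subset y] by simp_all
    ultimately show thesis
      using that unfolding eff_dom_def by simp
  qed
  obtain qs ws
    where left: "\<And>w. aug_lagrangian f RX RY A \<rho> qs w \<le> aug_lagrangian f RX RY A \<rho> qs ws"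
      and right: "\<And>q. aug_lagrangian f RX RY A \<rho> qs ws \<le> aug_lagrangian f RX RY A \<rho> q ws"
    using \<open>has_saddle_point (aug_lagrangian f RX RY A \<rho>)\<close> unfolding has_saddle_point_def by blast
  have qs: "qs \<in> optimal_set f RX RY A"
    using saddle_point_imp_optimal[OF bot x0 left right] .
  have opt: "optimal_set f RX RY A = {qs}"
    using optimal_set_unique[OF bot(1) \<open>convex_fun RX\<close> bot(2) \<open>convex_fun RY\<close> \<open>linear A\<close>
        \<open>\<alpha> > 0\<close> \<open>strongly_convex \<alpha> f\<close> x0 _ qs] qs by blast
  have gap: "inner (qs - q) (grad (\<lambda>p. S_fun f A \<rho> p w) q)
      \<le> S_fun f A \<rho> qs w - S_fun f A \<rho> q w - c / 2 * (norm (qs - q))\<^sup>2" for q w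
    using \<open>smooth_fun \<beta> f\<close> unfolding smooth_fun_def
    by (intro strongly_convex_first_order[OF S] S_fun_differentiable[OF \<open>linear A\<close>]) blast
  have "PQG f RX RY A \<rho> c"
    unfolding PQG_def opt
    by (intro conjI ballI exI[of _ qs] allI c gap) (auto simp: is_arg_min_def)
  then show ?thesis
    unfolding c_def[symmetric] using c S opt by auto
qed

end
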